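(* Let $n\ge1$, let $\boldsymbol{\Omega}\subset\mathbb{R}^n$ be a full-dimensional simplex, let $\mathbf{a}$ be a vertex of $\boldsymbol{\Omega}$ and let $\mathbf{A}$ be a nonsingular $n\times n$ real matrix such that $\mathbf{x}\in\boldsymbol{\Omega}$ if and only if $\mathbf{A}(\mathbf{x}-\mathbf{a})\in\boldsymbol{\Delta}$. Let $f\in\mathbb{R}[\mathbf{x}]$ be a polynomial of degree $t\in\mathbb{N}$, let $g(\mathbf{y}):=f(\mathbf{A}^{-1}\mathbf{y}+\mathbf{a})$ (a polynomial of the same degree as $f$), and write $g=\sum_{j=0}^t g_j$ with $g_j$ homogeneous of degree $j$. For $j=1,\ldots,t$ let $\boldsymbol{\xi}_j=\mathbf{e}/((n+1)\cdots(n+j))^{1/j}\in\boldsymbol{\Delta}$ and $\boldsymbol{\psi}_j:=\mathbf{A}^{-1}\boldsymbol{\xi}_j+\mathbf{a}$. Then $\boldsymbol{\psi}_j\in\boldsymbol{\Omega}$ for $j=1,\ldots,t$, and $$\int_{\boldsymbol{\Omega}} f(\mathbf{x})\,d\mathbf{x}=\frac{1}{|\det(\mathbf{A})|}\,\frac{1}{n!}\Big[\hat g_0+\sum_{j=1}^t\hat g_j\big(\mathbf{A}(\boldsymbol{\psi}_j-\mathbf{a})\big)\Big].$$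
   Context: $\mathbf{e}=(1,\ldots,1)\in\mathbb{R}^n$ and $\boldsymbol{\Delta}=\{\mathbf{x}\in\mathbb{R}^n:\mathbf{x}\ge 0,\ \mathbf{e}^T\mathbf{x}\le1\}$ is the canonical simplex. A simplex is full-dimensional if its $n$-dimensional Lebesgue volume is strictly positive. Integrals are with respect to Lebesgue measure. For a polynomial $h(\mathbf{x})=\sum_{\alpha\in\mathbb{N}^n}h_\alpha\mathbf{x}^\alpha$, its Bombieri polynomial is $\hat h(\mathbf{x})=\sum_{\alpha\in\mathbb{N}^n}h_\alpha\,\alpha_1!\cdots\alpha_n!\,\mathbf{x}^\alpha$ (so for the constant form $g_0$, $\hat g_0=g_0$). *)

theory Defs
  imports "HOL-Analysis.Analysis" "HOL-Library.Poly_Mapping"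
begin

text \<open>
  Real polynomials in the coordinates of \<^typ>\<open>real ^ 'n\<close>: finitely supported maps from exponents
  \<open>\<alpha>\<close> to coefficients. The ring operations are those of \<^type>\<open>poly_mapping\<close>.
\<close>

type_synonym 'n real_mpoly = "('n \<Rightarrow>\<^sub>0 nat) \<Rightarrow>\<^sub>0 real"

definition monom_degree :: "('n::finite \<Rightarrow>\<^sub>0 nat) \<Rightarrow> nat" where
  "monom_degree \<alpha> = (\<Sum>i\<in>UNIV. Poly_Mapping.lookup \<alpha> i)"

text \<open>The zero polynomial gets degree \<open>0\<close>.\<close>

definition total_degree :: "'n::finite real_mpoly \<Rightarrow> nat" where
  "total_degree p = Max (insert 0 (monom_degree ` Poly_Mapping.keys p))"

definition poly_eval :: "'n::finite real_mpoly \<Rightarrow> real ^ 'n \<Rightarrow> real" where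
  "poly_eval p x =
     (\<Sum>\<alpha>\<in>Poly_Mapping.keys p. Poly_Mapping.lookup p \<alpha> * (\<Prod>i\<in>UNIV. (x $ i) ^ Poly_Mapping.lookup \<alpha> i))"

definition const_poly :: "real \<Rightarrow> 'n real_mpoly" where
  "const_poly c = Poly_Mapping.single 0 c"

definition var_poly :: "'n \<Rightarrow> 'n real_mpoly" where
  "var_poly i = Poly_Mapping.single (Poly_Mapping.single i 1) 1"

definition hom_component :: "nat \<Rightarrow> 'n::finite real_mpoly \<Rightarrow> 'n real_mpoly" where
  "hom_component j p = Poly_Mapping.mapp (\<lambda>\<alpha> c. if monom_degree \<alpha> = j then c else 0) p"

definition bombieri :: "'n::finite real_mpoly \<Rightarrow> 'n real_mpoly" where
  "bombieri p = Poly_Mapping.mapp (\<lambda>\<alpha> c. c * (\<Prod>i\<in>UNIV. fact (Poly_Mapping.lookup \<alpha> i))) p"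

text \<open>The polynomial \<open>p(B y + b)\<close> in the variables \<open>y\<close>; see \<open>poly_eval_affine_subst\<close> below.\<close>

definition affine_subst :: "'n::finite real_mpoly \<Rightarrow> real ^ 'n ^ 'n \<Rightarrow> real ^ 'n \<Rightarrow> 'n real_mpoly" where
  "affine_subst p B b =
     (\<Sum>\<alpha>\<in>Poly_Mapping.keys p. const_poly (Poly_Mapping.lookup p \<alpha>) *
        (\<Prod>i\<in>UNIV. ((\<Sum>j\<in>UNIV. const_poly (B $ i $ j) * var_poly j) + const_poly (b $ i))
                      ^ Poly_Mapping.lookup \<alpha> i))"

text \<open>Here \<open>\<le>\<close> on vectors is componentwise and \<open>1\<close> is the all-ones vector.\<close>

definition canonical_simplex :: "(real ^ 'n) set" where
  "canonical_simplex = {x. 0 \<le> x \<and> 1 \<bullet> x \<le> 1}"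

definition full_dimensional_simplex :: "(real ^ 'n) set \<Rightarrow> bool" where
  "full_dimensional_simplex S \<longleftrightarrow> (\<exists>k. k simplex S) \<and> 0 < measure lebesgue S"

lemma lookup_hom_component:
  "Poly_Mapping.lookup (hom_component j p) \<alpha> =
     (if monom_degree \<alpha> = j then Poly_Mapping.lookup p \<alpha> else 0)"
  by (simp add: hom_component_def lookup_mapp when_def in_keys_iff)

lemma sum_hom_component: "(\<Sum>j\<le>total_degree p. hom_component j p) = p"
proof (rule poly_mapping_eqI)
  fix \<alpha>
  have "monom_degree \<alpha> \<le> total_degree p" if "\<alpha> \<in> Poly_Mapping.keys p"
    using that by (simp add: total_degree_def)
  then show "Poly_Mapping.lookup (\<Sum>j\<le>total_degree p. hom_component j p) \<alpha> = Poly_Mapping.lookup p \<alpha>"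
    by (auto simp: lookup_sum lookup_hom_component in_keys_iff)
qed

lemma poly_eval_superset:
  assumes "finite S" "Poly_Mapping.keys p \<subseteq> S"
  shows "poly_eval p x =
    (\<Sum>\<alpha>\<in>S. Poly_Mapping.lookup p \<alpha> * (\<Prod>i\<in>UNIV. (x $ i) ^ Poly_Mapping.lookup \<alpha> i))"
  unfolding poly_eval_def using assms
  by (intro sum.mono_neutral_left) (auto simp: in_keys_iff)

lemma poly_eval_add: "poly_eval (p + q) x = poly_eval p x + poly_eval q x"
proof -
  have fin: "finite (Poly_Mapping.keys p \<union> Poly_Mapping.keys q)" by simp
  show ?thesis
    using Poly_Mapping.keys_add[of p q]
    by (simp add: poly_eval_superset[OF fin] lookup_add distrib_right sum.distrib)
qed

lemma poly_eval_zero: "poly_eval 0 x = 0"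
  by (simp add: poly_eval_def)

lemma poly_eval_sum: "poly_eval (sum P I) x = (\<Sum>i\<in>I. poly_eval (P i) x)"
  by (induction I rule: infinite_finite_induct) (auto simp: poly_eval_zero poly_eval_add)

lemma poly_eval_single:
  "poly_eval (Poly_Mapping.single \<alpha> c) x = c * (\<Prod>i\<in>UNIV. (x $ i) ^ Poly_Mapping.lookup \<alpha> i)"
  by (simp add: poly_eval_def)

lemma sum_single: "p = (\<Sum>\<alpha>\<in>Poly_Mapping.keys p. Poly_Mapping.single \<alpha> (Poly_Mapping.lookup p \<alpha>))"
  by (rule poly_mapping_eqI)
    (auto simp: lookup_sum lookup_single when_def in_keys_iff)

lemma poly_eval_mult: "poly_eval (p * q) x = poly_eval p x * poly_eval q x"
proof -
  have 1: "poly_eval (Poly_Mapping.single \<alpha> c * Poly_Mapping.single \<beta> d) x =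
      poly_eval (Poly_Mapping.single \<alpha> c) x * poly_eval (Poly_Mapping.single \<beta> d) x" for \<alpha> \<beta> c d
    by (simp add: mult_single poly_eval_single lookup_add power_add prod.distrib mult_ac)
  show ?thesis
    by (subst (1 2 3 4) sum_single) (simp add: sum_product poly_eval_sum 1)
qed

lemma poly_eval_const: "poly_eval (const_poly c) x = c"
  by (simp add: const_poly_def poly_eval_single)

lemma poly_eval_var: "poly_eval (var_poly i) x = x $ i"
proof -
  have "(\<Prod>k\<in>UNIV. (x $ k) ^ Poly_Mapping.lookup (Poly_Mapping.single i 1) k)
      = (\<Prod>k\<in>UNIV. if k = i then x $ k else 1)"
    by (intro prod.cong) (auto simp: lookup_single)
  then show ?thesis
    by (simp add: var_poly_def poly_eval_single)
qed

lemma poly_eval_one: "poly_eval 1 x = 1"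
  using poly_eval_const[of 1 x] by (simp add: const_poly_def)

lemma poly_eval_power: "poly_eval (p ^ k) x = poly_eval p x ^ k"
  by (induction k) (auto simp: poly_eval_mult poly_eval_one)

lemma poly_eval_prod: "poly_eval (prod P I) x = (\<Prod>i\<in>I. poly_eval (P i) x)"
  by (induction I rule: infinite_finite_induct) (auto simp: poly_eval_one poly_eval_mult)

lemma poly_eval_affine_subst: "poly_eval (affine_subst p B b) y = poly_eval p (B *v y + b)"
  by (simp add: affine_subst_def poly_eval_sum poly_eval_mult poly_eval_prod poly_eval_power
      poly_eval_add poly_eval_const poly_eval_var matrix_vector_mult_def)
    (simp add: poly_eval_def)

end

theory Submission
  imports Defs
begin

text \<open>
  The substitution \<open>x = A\<^sup>-\<^sup>1 y + a\<close> turns the integral into \<open>1 / \<bar>det A\<bar>\<close> times that of \<open>g\<close> over the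
  canonical simplex, where Dirichlet's formula gives \<open>\<alpha>! / (n + \<bar>\<alpha>\<bar>)!\<close> for the monomial \<open>y\<^sup>\<alpha>\<close>. The
  Bombieri weights supply \<open>\<alpha>!\<close>, and evaluating a form of degree \<open>j\<close> at \<open>\<xi>\<^sub>j\<close> supplies the factor
  \<open>1 / ((n+1) \<cdots> (n+j)) = n! / (n+j)!\<close>.

  The change-of-variables theorems of HOL-Analysis require the index type to be a wellorder.
  For an arbitrary finite index type, the linear case follows from uniqueness of
  translation-invariant measures and a decomposition into elementary matrices.
\<close>

section \<open>Integrals of monomials over the canonical simplex\<close>

text \<open>Integration by parts: each step trades a factor \<open>y\<close> for a factor
  \<open>t - y\<close>, hence the induction on \<open>a\<close> with \<open>m\<close>
  arbitrary.\<close>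

lemma has_integral_beta_nat:
  fixes t :: real
  assumes "0 \<le> t"
  shows "((\<lambda>y. y ^ a * (t - y) ^ m) has_integral
          fact a * fact m / fact (Suc (a + m)) * t ^ Suc (a + m)) {0..t}"
proof (induction a arbitrary: m)
  case 0
  have "((\<lambda>y. (t - y) ^ m) has_integral (- ((t - t) ^ Suc m / Suc m) - (- ((t - 0) ^ Suc m / Suc m)))) {0..t}"
    using assms
    by (intro fundamental_theorem_of_calculus)
       (auto intro!: derivative_eq_intros simp: has_real_derivative_iff_has_vector_derivative[symmetric]
          simp del: of_nat_Suc power_Suc)
  then show ?case by (simp add: field_simps del: of_nat_Suc)
next
  case (Suc a)
  \<comment> \<open>The boundary term. It vanishes at \<open>0\<close> and at \<open>t\<close>, so
    its derivative integrates to 0, and the case (\<open>Suc a\<close>, \<open>m\<close>) becomes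
    \<open>Suc a / Suc m\<close> times the case (\<open>a\<close>, \<open>Suc m\<close>).\<close>
  define F where "F = (\<lambda>y. y ^ Suc a * (t - y) ^ Suc m / Suc m)"
  have "(F has_real_derivative
          Suc a / Suc m * (y ^ a * (t - y) ^ Suc m) - y ^ Suc a * (t - y) ^ m) (at y within {0..t})" for y
    unfolding F_def
    by (rule derivative_eq_intros refl | simp del: of_nat_Suc power_Suc)+
       (simp add: field_simps del: of_nat_Suc)
  then have "((\<lambda>y. Suc a / Suc m * (y ^ a * (t - y) ^ Suc m) - y ^ Suc a * (t - y) ^ m)
      has_integral (F t - F 0)) {0..t}"
    using assms
    by (intro fundamental_theorem_of_calculus)
       (auto simp: has_real_derivative_iff_has_vector_derivative[symmetric])
  from has_integral_diff[OF has_integral_mult_right[OF Suc.IH[of "Suc m"], of "Suc a / Suc m"] this]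
  have "((\<lambda>y. y ^ Suc a * (t - y) ^ m) has_integral
     Suc a / Suc m * (fact a * fact (Suc m) / fact (Suc (a + Suc m)) * t ^ Suc (a + Suc m))) {0..t}"
    by (simp add: F_def)
  also have "Suc a / Suc m * (fact a * fact (Suc m) / fact (Suc (a + Suc m)) * t ^ Suc (a + Suc m)) =
     fact (Suc a) * fact m / fact (Suc (Suc a + m)) * t ^ Suc (Suc a + m)"
    by (simp only: fact_Suc[of a] fact_Suc[of m] add_Suc_right add_Suc) simp
  finally show ?case .
qed

text \<open>Fixing one coordinate at \<open>y\<close> leaves the same integral in one variable fewer
  with bound \<open>t - y\<close>, so the induction needs an arbitrary bound \<open>t\<close>. The
  outer integral over \<open>y\<close> is then a beta integral. Working with nonnegative integrals
  lets Tonelli apply directly.\<close>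

lemma nn_integral_dirichlet_PiM:
  fixes \<alpha> :: "'a \<Rightarrow> nat"
  assumes "finite I" "0 \<le> t"
  shows "(\<integral>\<^sup>+x. ennreal (\<Prod>i\<in>I. x i ^ \<alpha> i) * indicator {x. (\<forall>i\<in>I. 0 \<le> x i) \<and> sum x I \<le> t} x
            \<partial>Pi\<^sub>M I (\<lambda>_. lborel)) =
         ennreal ((\<Prod>i\<in>I. fact (\<alpha> i)) / fact (card I + sum \<alpha> I) * t ^ (card I + sum \<alpha> I))"
  using assms
proof (induction arbitrary: t rule: finite_induct)
  case empty
  then show ?case by (simp add: PiM_empty nn_integral_count_space_finite)
next
  case (insert b I)
  define m where "m = card I + sum \<alpha> I"
  define c :: real where "c = (\<Prod>i\<in>I. fact (\<alpha> i)) / fact m"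
  define f where "f = (\<lambda>J t x. ennreal (\<Prod>i\<in>J. x i ^ \<alpha> i) *
     indicator {x. (\<forall>i\<in>J. 0 \<le> x i) \<and> sum x J \<le> t} x)" for J and t :: real
  interpret product_sigma_finite "\<lambda>_. lborel" by standard
  have meas: "f J s \<in> borel_measurable (Pi\<^sub>M J (\<lambda>_. lborel))" if "finite J" for J s
  proof -
    \<comment> \<open>Measurability becomes visible once the simplex is cut out by one-dimensional
      indicators and one condition on the sum.\<close>
    have "f J s = (\<lambda>x. ennreal (\<Prod>i\<in>J. x i ^ \<alpha> i) * (\<Prod>i\<in>J. indicator {0..} (x i)) * indicator {..s} (sum x J))"
      using that by (auto simp: f_def fun_eq_iff indicator_def)
    then show ?thesis using that by simp
  qed
  have IH: "(\<integral>\<^sup>+x. f I s x \<partial>Pi\<^sub>M I (\<lambda>_. lborel)) = ennreal (c * s ^ m)" if "0 \<le> s" for s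
    unfolding f_def c_def m_def by (rule insert.IH[OF that])
  \<comment> \<open>The constraint \<open>y \<le> t\<close> follows from nonnegativity of the other
    coordinates. It is recorded as a separate indicator because the induction hypothesis applies
    only when \<open>0 \<le> t - y\<close>.\<close>
  have split: "f (insert b I) t (x(b := y)) = ennreal (y ^ \<alpha> b) * indicator {0..t} y * f I (t - y) x" for x y
  proof -
    have s: "(\<Prod>i\<in>I. (x(b := y)) i ^ \<alpha> i) = (\<Prod>i\<in>I. x i ^ \<alpha> i)" "sum (x(b := y)) I = sum x I"
      "(\<forall>i\<in>I. 0 \<le> (x(b := y)) i) \<longleftrightarrow> (\<forall>i\<in>I. 0 \<le> x i)"
      using insert.hyps by (auto intro!: prod.cong sum.cong)
    have p: "0 \<le> sum x I" "0 \<le> (\<Prod>i\<in>I. x i ^ \<alpha> i)" if "\<forall>i\<in>I. 0 \<le> x i"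
      using that by (auto intro!: sum_nonneg prod_nonneg)
    have "(\<forall>i\<in>insert b I. 0 \<le> (x(b := y)) i) \<and> sum (x(b := y)) (insert b I) \<le> t \<longleftrightarrow>
        y \<in> {0..t} \<and> (\<forall>i\<in>I. 0 \<le> x i) \<and> sum x I \<le> t - y"
      using insert.hyps p(1) by (simp add: s del: fun_upd_apply) auto
    moreover have "(\<Prod>i\<in>insert b I. (x(b := y)) i ^ \<alpha> i) = y ^ \<alpha> b * (\<Prod>i\<in>I. x i ^ \<alpha> i)"
      using insert.hyps by (simp add: s(1) del: fun_upd_apply) simp
    ultimately show ?thesis
      using p(2) unfolding f_def indicator_def
      by (simp add: ennreal_mult del: fun_upd_apply)
  qed
  have "(\<integral>\<^sup>+x. f (insert b I) t x \<partial>Pi\<^sub>M (insert b I) (\<lambda>_. lborel)) =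
        (\<integral>\<^sup>+y. \<integral>\<^sup>+x. f (insert b I) t (x(b := y)) \<partial>Pi\<^sub>M I (\<lambda>_. lborel) \<partial>lborel)"
    using insert.hyps by (intro product_nn_integral_insert_rev meas) auto
  also have "\<dots> = (\<integral>\<^sup>+y. ennreal (c * (y ^ \<alpha> b * (t - y) ^ m)) * indicator {0..t} y \<partial>lborel)"
  proof (rule nn_integral_cong)
    fix y :: real
    have "(\<integral>\<^sup>+x. f (insert b I) t (x(b := y)) \<partial>Pi\<^sub>M I (\<lambda>_. lborel)) =
        ennreal (y ^ \<alpha> b) * indicator {0..t} y * (\<integral>\<^sup>+x. f I (t - y) x \<partial>Pi\<^sub>M I (\<lambda>_. lborel))"
      unfolding split by (rule nn_integral_cmult[OF meas[OF insert.hyps(1)]])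
    then show "(\<integral>\<^sup>+x. f (insert b I) t (x(b := y)) \<partial>Pi\<^sub>M I (\<lambda>_. lborel)) =
        ennreal (c * (y ^ \<alpha> b * (t - y) ^ m)) * indicator {0..t} y"
      by (auto simp: IH indicator_def ennreal_mult' [symmetric] mult_ac)
  qed
  also have "\<dots> = ennreal (c * (fact (\<alpha> b) * fact m / fact (Suc (\<alpha> b + m)) * t ^ Suc (\<alpha> b + m)))"
    using insert.prems
    by (intro nn_integral_has_integral_lebesgue' has_integral_mult_right has_integral_beta_nat)
       (auto simp: c_def intro!: mult_nonneg_nonneg divide_nonneg_nonneg prod_nonneg)
  also have "c * (fact (\<alpha> b) * fact m / fact (Suc (\<alpha> b + m)) * t ^ Suc (\<alpha> b + m)) =
     (\<Prod>i\<in>insert b I. fact (\<alpha> i)) / fact (card (insert b I) + sum \<alpha> (insert b I)) *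
      t ^ (card (insert b I) + sum \<alpha> (insert b I))"
    using insert.hyps by (simp add: c_def m_def field_simps add_ac)
  finally show ?case unfolding f_def .
qed

lemma canonical_simplex_iff:
  "x \<in> canonical_simplex \<longleftrightarrow> (\<forall>i. 0 \<le> x $ i) \<and> (\<Sum>i\<in>UNIV. x $ i) \<le> 1"
  by (simp add: canonical_simplex_def less_eq_vec_def inner_vec_def)

lemma closed_canonical_simplex: "closed (canonical_simplex :: (real ^ 'n) set)"
proof -
  have "canonical_simplex = (\<Inter>i. {x :: real ^ 'n. 0 \<le> x $ i}) \<inter> {x. (\<Sum>i\<in>UNIV. x $ i) \<le> 1}"
    by (auto simp: canonical_simplex_iff)
  also have "closed \<dots>"
    by (intro closed_Int closed_INT closed_Collect_le continuous_intros ballI)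
  finally show ?thesis .
qed

text \<open>\<open>lborel\<close> on vectors is the image of the product measure indexed by
  \<open>Basis\<close>, so the product formula carries over with bound 1.\<close>

lemma nn_integral_monomial_canonical_simplex:
  fixes \<alpha> :: "'n::finite \<Rightarrow> nat"
  shows "(\<integral>\<^sup>+x. ennreal (\<Prod>i\<in>UNIV. (x $ i) ^ \<alpha> i) * indicator canonical_simplex x \<partial>lborel) =
         ennreal ((\<Prod>i\<in>UNIV. fact (\<alpha> i)) / fact (CARD('n) + sum \<alpha> UNIV))"
proof -
  \<comment> \<open>The exponents relabelled by basis vectors: the product measure is indexed by
    \<open>Basis\<close>, not by \<open>'n\<close>.\<close>
  define \<beta> :: "real ^ 'n \<Rightarrow> nat" where "\<beta> = (\<lambda>b. \<alpha> (inv (\<lambda>i. axis i 1) b))"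
  have inj: "inj (\<lambda>i::'n. axis i (1::real))"
    by (auto simp: inj_on_def axis_eq_axis)
  have \<beta>: "\<beta> (axis i 1) = \<alpha> i" for i
    unfolding \<beta>_def by (simp add: inv_f_f[OF inj])
  have B: "Basis = range (\<lambda>i::'n. axis i (1::real))"
    by (auto simp: Basis_vec_def)
  have comp: "(\<Sum>b\<in>Basis. f b *\<^sub>R b) $ i = f (axis i 1)" for f :: "real ^ 'n \<Rightarrow> real" and i
    using inner_sum_left_Basis[of "axis i 1" f] by (simp add: B inner_axis)
  have [measurable]: "canonical_simplex \<in> sets (borel :: (real ^ 'n) measure)"
    by (intro borel_closed closed_canonical_simplex)
  have "(\<integral>\<^sup>+x. ennreal (\<Prod>i\<in>UNIV. (x $ i) ^ \<alpha> i) * indicator canonical_simplex x \<partial>lborel) =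
    (\<integral>\<^sup>+x. ennreal (\<Prod>i\<in>UNIV. ((\<Sum>b\<in>Basis. x b *\<^sub>R b) $ i) ^ \<alpha> i) *
       indicator canonical_simplex (\<Sum>b\<in>Basis. x b *\<^sub>R b :: real ^ 'n) \<partial>(\<Pi>\<^sub>M b\<in>Basis. lborel))"
    by (subst lborel_eq, subst nn_integral_distr) auto
  also have "\<dots> = (\<integral>\<^sup>+x. ennreal (\<Prod>b\<in>Basis. x b ^ \<beta> b) *
      indicator {x. (\<forall>b\<in>Basis. 0 \<le> x b) \<and> sum x Basis \<le> 1} x \<partial>Pi\<^sub>M (Basis :: (real ^ 'n) set) (\<lambda>_. lborel))"
  proof -
    have "(\<Prod>b\<in>Basis. x b ^ \<beta> b) = (\<Prod>i\<in>UNIV. x (axis i 1) ^ \<alpha> i)"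
      "sum x Basis = (\<Sum>i\<in>UNIV. x (axis i 1))"
      "(\<forall>b\<in>Basis. 0 \<le> x b) \<longleftrightarrow> (\<forall>i. 0 \<le> x (axis i 1))" for x :: "real ^ 'n \<Rightarrow> real"
      by (simp_all add: B prod.reindex[OF inj] sum.reindex[OF inj] \<beta>)
    then show ?thesis
      by (intro nn_integral_cong) (simp only: indicator_def canonical_simplex_iff comp mem_Collect_eq)
  qed
  also have "\<dots> = ennreal ((\<Prod>i\<in>UNIV. fact (\<alpha> i)) / fact (CARD('n) + sum \<alpha> UNIV))"
    by (subst nn_integral_dirichlet_PiM)
       (simp_all add: B prod.reindex[OF inj] sum.reindex[OF inj] card_image[OF inj] \<beta>)
  finally show ?thesis .
qed

section \<open>Linear maps and Lebesgue measure\<close>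

text \<open>The classical Fubini argument for the uniqueness of Haar measure; it is stated without
  division so that infinite or zero values need no separate treatment.\<close>

lemma translation_invariant_emeasure:
  fixes M :: "'a::euclidean_space measure"
  assumes "sigma_finite_measure M" and sets: "sets M = sets borel"
    and inv: "\<And>c. distr M borel ((+) c) = M"
    and [measurable]: "E \<in> sets borel" "Q \<in> sets borel"
  shows "emeasure lborel E * emeasure M Q = emeasure M E * emeasure lborel Q"
proof -
  interpret M: sigma_finite_measure M by fact
  interpret pair_sigma_finite lborel M ..
  note sets[measurable_cong]
  have shift_lborel: "(\<integral>\<^sup>+x. f (y + x) \<partial>lborel) = (\<integral>\<^sup>+x. f x \<partial>lborel)"
    if [measurable]: "f \<in> borel_measurable borel" for f :: "'a \<Rightarrow> ennreal" and y
    by (subst (2) lborel_distr_plus[of y, symmetric]) (simp add: nn_integral_distr)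
  have shift_M: "(\<integral>\<^sup>+x. f (y + x) \<partial>M) = (\<integral>\<^sup>+x. f x \<partial>M)"
    if [measurable]: "f \<in> borel_measurable borel" for f :: "'a \<Rightarrow> ennreal" and y
    by (subst (2) inv[of y, symmetric]) (simp add: nn_integral_distr)
  \<comment> \<open>Lebesgue measure is also invariant under \<open>x \<mapsto> y - x\<close>, the
    affine map with factor -1.\<close>
  have reflect: "(\<integral>\<^sup>+x. indicator Q (y - x) \<partial>lborel) = emeasure lborel Q" for y
  proof -
    have "lborel = distr lborel borel (\<lambda>x. y - x)"
      using lborel_affine[of "-1" y] by (simp add: density_1)
    then have "emeasure lborel Q = emeasure (distr lborel borel (\<lambda>x. y - x)) Q"
      by (rule arg_cong)
    also have "\<dots> = (\<integral>\<^sup>+x. indicator Q x \<partial>distr lborel borel (\<lambda>x. y - x))"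
      by (rule nn_integral_indicator[symmetric]) simp
    also have "\<dots> = (\<integral>\<^sup>+x. indicator Q (y - x) \<partial>lborel)"
      by (rule nn_integral_distr) auto
    finally show ?thesis by (rule sym)
  qed
  \<comment> \<open>Shift \<open>x\<close> by \<open>y\<close> under \<open>lborel\<close>, exchange
    the integrals, shift \<open>y\<close> by \<open>-x\<close> under \<open>M\<close>, and exchange
    back. The inner integral of \<open>indicator Q (y - x)\<close> is then evaluated by
    \<open>reflect\<close>.\<close>
  have "emeasure lborel E * emeasure M Q =
      (\<integral>\<^sup>+y. \<integral>\<^sup>+x. indicator E x * indicator Q y \<partial>lborel \<partial>M)"
    by (simp add: nn_integral_multc nn_integral_cmult)
  also have "\<dots> = (\<integral>\<^sup>+y. \<integral>\<^sup>+x. indicator E (y + x) * indicator Q y \<partial>lborel \<partial>M)"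
    by (intro nn_integral_cong shift_lborel[symmetric]) measurable
  also have "\<dots> = (\<integral>\<^sup>+x. \<integral>\<^sup>+y. indicator E (y + x) * indicator Q y \<partial>M \<partial>lborel)"
    by (rule Fubini') measurable
  also have "\<dots> = (\<integral>\<^sup>+x. \<integral>\<^sup>+y. indicator E y * indicator Q (y - x) \<partial>M \<partial>lborel)"
  proof (rule nn_integral_cong)
    fix x :: 'a
    show "(\<integral>\<^sup>+y. indicator E (y + x) * indicator Q y \<partial>M) =
          (\<integral>\<^sup>+y. indicator E y * indicator Q (y - x) \<partial>M)"
      using shift_M[of "\<lambda>y. indicator E y * indicator Q (y - x)" x]
      by (simp add: add.commute)
  qed
  also have "\<dots> = (\<integral>\<^sup>+y. \<integral>\<^sup>+x. indicator E y * indicator Q (y - x) \<partial>lborel \<partial>M)"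
    by (rule Fubini'[symmetric]) measurable
  also have "\<dots> = emeasure M E * emeasure lborel Q"
    by (simp add: nn_integral_cmult nn_integral_multc reflect)
  finally show ?thesis .
qed

section \<open>Proportionality of Lebesgue measure and its image under a matrix\<close>

lemma borel_measurable_matrix_vector_mult [measurable]:
  "(*v) (A :: real ^ 'n ^ 'm) \<in> borel_measurable borel"
  by (intro borel_measurable_continuous_onI linear_continuous_on matrix_vector_mul_bounded_linear)

lemma sets_borel_vimage_matrix [measurable]:
  "E \<in> sets borel \<Longrightarrow> (*v) (A :: real ^ 'n ^ 'm) -` E \<in> sets borel"
  using measurable_sets[OF borel_measurable_matrix_vector_mult[of A], of E] by simp

lemma vimage_matrix_mult: "(*v) (A ** B) -` E = (*v) B -` ((*v) A -` E)"
  by (auto simp: matrix_vector_mul_assoc)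

lemma
  fixes A :: "real ^ 'n ^ 'n"
  assumes "invertible A"
  shows invertible_matrix_inv_right: "A ** matrix_inv A = mat 1"
    and invertible_matrix_inv_left: "matrix_inv A ** A = mat 1"
  using someI_ex[OF assms[unfolded invertible_def]] by (simp_all add: matrix_inv_def)

lemma emeasure_lborel_cbox_eq_content:
  "emeasure lborel (cbox a b) = ennreal (measure lborel (cbox a b))"
  using emeasure_lborel_cbox_finite[of a b] by (intro emeasure_eq_ennreal_measure) auto

text \<open>The image of \<open>lborel\<close> under \<open>A\<close> is again sigma-finite and
  translation-invariant, so \<open>translation_invariant_emeasure\<close> makes it proportional to
  \<open>lborel\<close>.\<close>

lemma emeasure_lborel_vimage_ratio:
  fixes A :: "real ^ 'n ^ 'n"
  assumes "invertible A" and [measurable]: "E \<in> sets borel" "Q \<in> sets borel"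
  shows "emeasure lborel E * emeasure lborel ((*v) A -` Q) =
         emeasure lborel ((*v) A -` E) * emeasure lborel Q"
proof -
  let ?M = "distr lborel borel ((*v) A)"
  \<comment> \<open>Sigma-finiteness is pulled back from a further image: pushing \<open>?M\<close>
    forward along the inverse matrix returns \<open>lborel\<close>.\<close>
  have "distr ?M lborel ((*v) (matrix_inv A)) = distr lborel lborel (\<lambda>x. x)"
    by (subst distr_distr)
       (simp_all add: comp_def matrix_vector_mul_assoc invertible_matrix_inv_left[OF assms(1)] measurable_lborel1)
  also have "\<dots> = lborel"
    by (rule distr_id2) simp
  finally have "sigma_finite_measure ?M"
    by (intro sigma_finite_measure_distr[of ?M lborel "(*v) (matrix_inv A)"])
       (auto intro: lborel.sigma_finite_measure_axioms)
  moreover have "distr ?M borel ((+) c) = ?M" for c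
  proof -
    \<comment> \<open>Translating the image by \<open>c\<close> amounts to translating the source by
      the preimage of \<open>c\<close>.\<close>
    define d where "d = matrix_inv A *v c"
    have "A *v (d + x) = c + A *v x" for x
      by (simp add: d_def matrix_vector_right_distrib matrix_vector_mul_assoc invertible_matrix_inv_right[OF assms(1)])
    then have "distr ?M borel ((+) c) = distr (distr lborel borel ((+) d)) borel ((*v) A)"
      by (subst (1 2) distr_distr) (auto intro!: distr_cong)
    then show ?thesis
      by (simp add: lborel_distr_plus)
  qed
  ultimately have "emeasure lborel E * emeasure ?M Q = emeasure ?M E * emeasure lborel Q"
    by (intro translation_invariant_emeasure) auto
  then show ?thesis
    by (simp add: emeasure_distr)
qed

text \<open>By proportionality the scaling factor can be read off from a single set of positive
  finite measure. The symmetric cube is convenient because reflections and permutations of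
  coordinates preserve it.\<close>

lemma emeasure_lborel_vimage_scale:
  fixes A :: "real ^ 'n ^ 'n"
  assumes A: "invertible A" and E: "E \<in> sets borel"
    and Q: "ennreal c * emeasure lborel ((*v) A -` cbox (-1) 1) = emeasure lborel (cbox (-1 :: real ^ 'n) 1)"
  shows "ennreal c * emeasure lborel ((*v) A -` E) = emeasure lborel E"
proof -
  let ?Q = "cbox (-1 :: real ^ 'n) 1"
  have pos: "emeasure lborel ?Q \<noteq> 0"
    by (simp add: emeasure_lborel_cbox_eq_content content_cbox_cart interval_eq_empty_cart)
  have fin: "emeasure lborel ?Q \<noteq> \<infinity>"
    by (simp add: emeasure_lborel_cbox_eq_content)
  have "emeasure lborel ?Q * (ennreal c * emeasure lborel ((*v) A -` E)) =
        ennreal c * (emeasure lborel ((*v) A -` E) * emeasure lborel ?Q)"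
    by (simp only: mult_ac)
  also have "\<dots> = emeasure lborel E * (ennreal c * emeasure lborel ((*v) A -` ?Q))"
    by (subst emeasure_lborel_vimage_ratio[OF A E, symmetric]) (simp_all only: mult_ac borel_closed closed_cbox)
  also have "\<dots> = emeasure lborel ?Q * emeasure lborel E"
    by (simp only: Q mult.commute)
  finally have "emeasure lborel ?Q * (ennreal c * emeasure lborel ((*v) A -` E)) =
        emeasure lborel ?Q * emeasure lborel E" .
  then show ?thesis
    using pos fin by (simp add: ennreal_mult_cancel_left)
qed

section \<open>Scaling factors of elementary matrices and the determinant formula\<close>

lemma emeasure_lborel_vimage_diagonal:
  fixes A :: "real ^ 'n ^ 'n"
  assumes diag: "\<And>i j. i \<noteq> j \<Longrightarrow> A $ i $ j = 0" and "det A \<noteq> 0" and E: "E \<in> sets borel"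
  shows "ennreal \<bar>det A\<bar> * emeasure lborel ((*v) A -` E) = emeasure lborel E"
proof (rule emeasure_lborel_vimage_scale[OF _ E])
  show "invertible A"
    using assms by (simp add: invertible_det_nz)
  have det: "det A = (\<Prod>i\<in>UNIV. A $ i $ i)"
    using diag by (rule det_diagonal)
  then have nz: "A $ i $ i \<noteq> 0" for i
    using assms(2) by auto
  have mult: "(A *v x) $ i = A $ i $ i * x $ i" for x i
  proof -
    have "(A *v x) $ i = (\<Sum>j\<in>UNIV. if j = i then A $ i $ i * x $ i else 0)"
      unfolding matrix_vector_mult_def vec_lambda_beta by (rule sum.cong) (auto simp: diag)
    then show ?thesis by simp
  qed
  \<comment> \<open>Half-widths of the box that \<open>A\<close> maps onto the cube; its volume is
    \<open>2 ^ CARD('n)\<close> divided by \<open>\<bar>det A\<bar>\<close>.\<close>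
  let ?d = "\<chi> i. 1 / \<bar>A $ i $ i\<bar> :: real ^ 'n"
  have "(-1 \<le> A $ i $ i * y \<and> A $ i $ i * y \<le> 1) \<longleftrightarrow> (- (1 / \<bar>A $ i $ i\<bar>) \<le> y \<and> y \<le> 1 / \<bar>A $ i $ i\<bar>)" for i y
    using nz[of i] by (auto simp: field_simps abs_if)
  then have "(*v) A -` cbox (-1) 1 = cbox (- ?d) ?d"
    by (auto simp: mem_box_cart mult)
  moreover have "measure lborel (cbox (-1 :: real ^ 'n) 1) = 2 ^ CARD('n)"
    by (subst content_cbox_cart) (auto simp: interval_eq_empty_cart)
  moreover have "measure lborel (cbox (- ?d) ?d) = (\<Prod>i\<in>UNIV. 2 * (1 / \<bar>A $ i $ i\<bar>))"
    by (subst content_cbox_cart) (auto simp: interval_eq_empty_cart not_less intro!: prod.cong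
      intro: order_trans[of _ 0])
  then have "\<bar>det A\<bar> * measure lborel (cbox (- ?d) ?d) = 2 ^ CARD('n)"
    using nz by (simp add: det abs_prod prod.distrib [symmetric] prod_dividef)
  ultimately show "ennreal \<bar>det A\<bar> * emeasure lborel ((*v) A -` cbox (-1) 1) = emeasure lborel (cbox (-1 :: real ^ 'n) 1)"
    by (simp add: emeasure_lborel_cbox_eq_content ennreal_mult' [symmetric])
qed

text \<open>Conjugating a shear with the reflection of the sheared coordinate yields the inverse shear, so
  the scaling factor of the shear equals its own reciprocal.\<close>

lemma emeasure_lborel_vimage_shear:
  fixes m n :: "'n::finite" and c :: real
  defines "S \<equiv> (\<lambda>c. (\<chi> i j. if i = m \<and> j = n then c else of_bool (i = j)) :: real ^ 'n ^ 'n)"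
  assumes "m \<noteq> n" and E: "E \<in> sets borel"
  shows "det (S c) = 1" and "emeasure lborel ((*v) (S c) -` E) = emeasure lborel E"
proof -
  have mult: "S c *v x = (\<chi> i. if i = m then x $ m + c * x $ n else x $ i)" for c x
  proof -
    have "(S c *v x) $ i = (\<Sum>j\<in>UNIV. (if j = i then x $ i else 0) + (if j = n then if i = m then c * x $ n else 0 else 0))" for i
      unfolding matrix_vector_mult_def S_def using \<open>m \<noteq> n\<close> by (auto intro!: sum.cong)
    then show ?thesis
      by (simp add: vec_eq_iff sum.distrib)
  qed
  have "S c = (\<chi> k. if k = m then row m (mat 1) + c *s row n (mat 1) else row k (mat 1))" for c
    using \<open>m \<noteq> n\<close> by (auto simp: S_def vec_eq_iff row_def mat_def)
  then have det: "det (S c) = 1" for c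
    using det_row_operation[OF \<open>m \<noteq> n\<close>, of "mat 1 :: real ^ 'n ^ 'n" c] by simp
  then show "det (S c) = 1" .
  have inv: "invertible (S c)" for c
    by (simp add: invertible_det_nz det)
  \<comment> \<open>The reflection of coordinate \<open>m\<close>: diagonal of determinant -1, hence
    measure-preserving, and it fixes the cube.\<close>
  define D :: "real ^ 'n ^ 'n" where "D = (\<chi> i j. if i = j then if i = m then -1 else 1 else 0)"
  let ?Q = "cbox (-1 :: real ^ 'n) 1"
  have D: "D *v x = (\<chi> i. if i = m then - x $ m else x $ i)" for x
  proof -
    have "(D *v x) $ i = (\<Sum>j\<in>UNIV. if j = i then if i = m then - x $ m else x $ i else 0)" for i
      unfolding matrix_vector_mult_def D_def vec_lambda_beta by (rule sum.cong) auto
    then show ?thesis by (simp add: vec_eq_iff)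
  qed
  have detD: "det D = -1"
    by (subst det_diagonal) (auto simp: D_def)
  have DQ: "(*v) D -` ?Q = ?Q"
  proof -
    have "-1 \<le> (D *v x) $ i \<and> (D *v x) $ i \<le> 1 \<longleftrightarrow> -1 \<le> x $ i \<and> x $ i \<le> 1" for x i
      by (auto simp: D)
    then show ?thesis
      by (simp add: mem_box_cart set_eq_iff)
  qed
  \<comment> \<open>This rests on \<open>D ** S (- c) = S c ** D\<close>, checked coordinatewise,
    together with the invariance of the cube under \<open>D\<close>.\<close>
  have conj: "(*v) (S (- c)) -` ?Q = (*v) D -` ((*v) (S c) -` ?Q)"
  proof -
    have "(*v) (S (- c)) -` ?Q = (*v) (S (- c)) -` ((*v) D -` ?Q)"
      by (simp only: DQ)
    also have "\<dots> = (*v) D -` ((*v) (S c) -` ?Q)"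
      using \<open>m \<noteq> n\<close> by (intro set_eqI) (auto simp: mult D intro!: arg_cong[where f = "\<lambda>x. x \<in> ?Q"] simp: vec_eq_iff)
    finally show ?thesis .
  qed
  have "emeasure lborel ((*v) (S (- c)) -` ?Q) = emeasure lborel ((*v) (S c) -` ?Q)"
    using emeasure_lborel_vimage_diagonal[of D "(*v) (S c) -` ?Q"] detD
    by (simp add: conj D_def)
  moreover have "(*v) (S (- c)) -` ((*v) (S c) -` ?Q) = ?Q"
    using \<open>m \<noteq> n\<close> by (intro set_eqI) (auto simp: mult vec_eq_iff mem_box_cart)
  \<comment> \<open>\<open>emeasure_lborel_vimage_ratio\<close> for \<open>S (- c)\<close> is
    applied to the preimage of the cube under \<open>S c\<close>. Pulling back along both shears
    restores the cube, and by \<open>conj\<close> the two preimages have equal measure.\<close>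
  ultimately have sq: "emeasure lborel ((*v) (S c) -` ?Q) * emeasure lborel ((*v) (S c) -` ?Q) =
      emeasure lborel ?Q * emeasure lborel ?Q"
    using emeasure_lborel_vimage_ratio[OF inv[of "-c"], of "(*v) (S c) -` ?Q" ?Q] by simp
  \<comment> \<open>An infinite value would have an infinite square, against \<open>sq\<close>. With
    both sides finite, nonnegative square roots can be taken.\<close>
  then have "emeasure lborel ((*v) (S c) -` ?Q) \<noteq> \<infinity>"
    by (auto simp: emeasure_lborel_cbox_eq_content ennreal_mult'[symmetric])
  with sq have "emeasure lborel ((*v) (S c) -` ?Q) = emeasure lborel ?Q"
    by (cases "emeasure lborel ((*v) (S c) -` ?Q)")
       (auto simp: emeasure_lborel_cbox_eq_content ennreal_mult'[symmetric] abs_of_nonneg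
          dest!: power2_eq_imp_eq[unfolded power2_eq_square])
  then show "emeasure lborel ((*v) (S c) -` E) = emeasure lborel E"
    using emeasure_lborel_vimage_scale[OF inv E, of 1 c] by simp
qed

text \<open>Exchanging two coordinates preserves the cube. \<open>S\<close> is written in the form
  in which \<open>induct_matrix_elementary\<close> presents transpositions.\<close>

lemma emeasure_lborel_vimage_swap:
  fixes m n :: "'n::finite"
  defines "S \<equiv> (\<chi> i j. mat 1 $ i $ Transposition.transpose m n j) :: real ^ 'n ^ 'n"
  assumes "E \<in> sets borel"
  shows "\<bar>det S\<bar> = 1" and "emeasure lborel ((*v) S -` E) = emeasure lborel E"
proof -
  show det: "\<bar>det S\<bar> = 1"
    by (simp add: S_def det_permute_columns permutes_swap_id sign_swap_id abs_mult)
  have "(S *v x) $ i = x $ Transposition.transpose m n i" for x i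
  proof -
    have "(S *v x) $ i = (\<Sum>j\<in>UNIV. if j = Transposition.transpose m n i then x $ j else 0)"
      unfolding matrix_vector_mult_def S_def mat_def vec_lambda_beta
      by (rule sum.cong) auto
    then show ?thesis by simp
  qed
  then have "(*v) S -` cbox (-1) 1 = cbox (-1) 1"
    by (simp add: mem_box_cart set_eq_iff) (metis transpose_involutory)
  with det show "emeasure lborel ((*v) S -` E) = emeasure lborel E"
    using emeasure_lborel_vimage_scale[OF _ assms(2), of S 1] by (simp add: invertible_det_nz)
qed

text \<open>Both the determinant and the scaling of preimages are multiplicative along matrix
  products, so the elementary factors decide.\<close>

lemma emeasure_lborel_vimage_matrix:
  fixes A :: "real ^ 'n ^ 'n"
  assumes "det A \<noteq> 0" "E \<in> sets borel"
  shows "ennreal \<bar>det A\<bar> * emeasure lborel ((*v) A -` E) = emeasure lborel E"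
  using assms
proof (induction A arbitrary: E rule: induct_matrix_elementary)
  case (1 A B)
  then have nz: "det A \<noteq> 0" "det B \<noteq> 0"
    by (auto simp: det_mul)
  have "ennreal \<bar>det (A ** B)\<bar> * emeasure lborel ((*v) (A ** B) -` E) =
      ennreal \<bar>det A\<bar> * (ennreal \<bar>det B\<bar> * emeasure lborel ((*v) B -` ((*v) A -` E)))"
    by (simp add: det_mul abs_mult ennreal_mult vimage_matrix_mult mult.assoc)
  then show ?case
    using 1 nz by simp
next
  \<comment> \<open>A matrix with a zero row is excluded by \<open>det A \<noteq> 0\<close>.\<close>
  case (2 A i)
  then show ?case by (simp add: det_zero_row)
next
  case (3 A)
  then show ?case by (intro emeasure_lborel_vimage_diagonal) auto
next
  case (4 m n)
  then show ?case by (simp add: emeasure_lborel_vimage_swap)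
next
  case (5 m n c)
  then show ?case by (simp add: emeasure_lborel_vimage_shear)
qed

text \<open>\<open>lborel\<close> is its own image under \<open>A\<close> with constant density
  \<open>\<bar>det A\<bar>\<close>; the shift by \<open>b\<close> is absorbed by translation
  invariance.\<close>

lemma integral_lborel_affine:
  fixes A :: "real ^ 'n ^ 'n" and f :: "real ^ 'n \<Rightarrow> real"
  assumes "det A \<noteq> 0" and [measurable]: "f \<in> borel_measurable borel"
  shows "\<bar>det A\<bar> * (LINT x|lborel. f (A *v x + b)) = (LINT x|lborel. f x)"
proof -
  have "lborel = density (distr lborel borel ((*v) A)) (\<lambda>_. ennreal \<bar>det A\<bar>)"
  proof (rule measure_eqI)
    fix E :: "(real ^ 'n) set" assume "E \<in> sets lborel"
    then have [measurable]: "E \<in> sets borel" by simp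
    have "emeasure (density (distr lborel borel ((*v) A)) (\<lambda>_. ennreal \<bar>det A\<bar>)) E =
        ennreal \<bar>det A\<bar> * emeasure lborel ((*v) A -` E)"
      by (subst emeasure_density_const) (simp_all add: emeasure_distr)
    then show "emeasure lborel E = emeasure (density (distr lborel borel ((*v) A)) (\<lambda>_. ennreal \<bar>det A\<bar>)) E"
      using emeasure_lborel_vimage_matrix[OF assms(1)] by simp
  qed simp
  then have "(LINT x|lborel. f (b + x)) =
     (LINT x|density (distr lborel borel ((*v) A)) (\<lambda>_. ennreal \<bar>det A\<bar>). f (b + x))"
    by (rule arg_cong)
  also have "\<dots> = \<bar>det A\<bar> * (LINT x|lborel. f (A *v x + b))"
    by (simp add: integral_density integral_distr add.commute)
  also have "(LINT x|lborel. f (b + x)) = (LINT x|distr lborel borel ((+) b). f x)"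
    by (simp add: integral_distr)
  finally show ?thesis
    by (simp add: lborel_distr_plus)
qed

section \<open>Affine substitution and total degree\<close>

lemma total_degree_le_iff: "total_degree p \<le> d \<longleftrightarrow> (\<forall>\<alpha>\<in>Poly_Mapping.keys p. monom_degree \<alpha> \<le> d)"
  by (simp add: total_degree_def)

lemma monom_degree_le_total_degree: "\<alpha> \<in> Poly_Mapping.keys p \<Longrightarrow> monom_degree \<alpha> \<le> total_degree p"
  using total_degree_le_iff[of p "total_degree p"] by simp

lemma total_degree_add: "total_degree (p + q) \<le> max (total_degree p) (total_degree q)"
  unfolding total_degree_le_iff
  using Poly_Mapping.keys_add[of p q] by (auto simp: le_max_iff_disj intro: monom_degree_le_total_degree)

lemma total_degree_mult: "total_degree (p * q) \<le> total_degree p + total_degree q"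
  unfolding total_degree_le_iff
proof
  fix \<gamma> assume "\<gamma> \<in> Poly_Mapping.keys (p * q)"
  then obtain \<alpha> \<beta> where "\<gamma> = \<alpha> + \<beta>" "\<alpha> \<in> Poly_Mapping.keys p" "\<beta> \<in> Poly_Mapping.keys q"
    using keys_mult[of p q] by blast
  then show "monom_degree \<gamma> \<le> total_degree p + total_degree q"
    using monom_degree_le_total_degree[of \<alpha> p] monom_degree_le_total_degree[of \<beta> q]
    by (simp add: monom_degree_def lookup_add sum.distrib)
qed

lemma total_degree_const [simp]: "total_degree (const_poly c) = 0"
  by (simp add: total_degree_def const_poly_def monom_degree_def)

lemma total_degree_var: "total_degree (var_poly i) \<le> 1"
  unfolding total_degree_le_iff by (simp add: var_poly_def monom_degree_def lookup_single when_def)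

lemma total_degree_sum:
  assumes "\<And>i. i \<in> I \<Longrightarrow> total_degree (p i) \<le> d"
  shows "total_degree (sum p I) \<le> d"
  using assms
proof (induction I rule: infinite_finite_induct)
  case (insert i I)
  then have "max (total_degree (p i)) (total_degree (sum p I)) \<le> d" by simp
  with order_trans[OF total_degree_add] show ?case by (simp add: insert.hyps)
qed (auto simp: total_degree_def)

lemma total_degree_power: "total_degree (p ^ k) \<le> k * total_degree p"
proof (induction k)
  case 0
  then show ?case by (simp add: total_degree_def monom_degree_def)
next
  case (Suc k)
  then show ?case using total_degree_mult[of p "p ^ k"] by simp
qed

lemma total_degree_prod: "total_degree (prod p I) \<le> (\<Sum>i\<in>I. total_degree (p i))"
proof (induction I rule: infinite_finite_induct)
  case (insert i I)
  then show ?case using total_degree_mult[of "p i" "prod p I"] by simp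
qed (auto simp: total_degree_def monom_degree_def)

section \<open>Affine substitution as a ring homomorphism\<close>

lemma const_poly_zero: "const_poly 0 = 0"
  by (simp add: const_poly_def)

lemma const_poly_one: "const_poly 1 = 1"
  by (simp add: const_poly_def)

lemma const_poly_add: "const_poly (c + d) = const_poly c + const_poly d"
  by (simp add: const_poly_def single_add)

lemma const_poly_mult: "const_poly (c * d) = const_poly c * const_poly d"
  by (simp add: const_poly_def mult_single)

lemma const_poly_sum: "const_poly (sum f I) = (\<Sum>i\<in>I. const_poly (f i))"
  by (induction I rule: infinite_finite_induct) (simp_all add: const_poly_zero const_poly_add)

lemma prod_single_one: "(\<Prod>i\<in>I. Poly_Mapping.single (\<beta> i) 1) = Poly_Mapping.single (sum \<beta> I) (1 :: 'a::comm_semiring_1)"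
  by (induction I rule: infinite_finite_induct) (simp_all add: mult_single)

text \<open>Monomials as products of variables: this is what makes the identity substitution return
  the polynomial itself.\<close>

lemma single_eq_const_mult_prod_var:
  fixes \<alpha> :: "'n::finite \<Rightarrow>\<^sub>0 nat"
  shows "Poly_Mapping.single \<alpha> c = const_poly c * (\<Prod>i\<in>UNIV. var_poly i ^ Poly_Mapping.lookup \<alpha> i)"
proof -
  have "var_poly i ^ k = Poly_Mapping.single (Poly_Mapping.single i k) 1" for i :: 'n and k
    by (induction k) (simp_all add: var_poly_def mult_single single_add[symmetric])
  moreover have "(\<Sum>i\<in>UNIV. Poly_Mapping.single i (Poly_Mapping.lookup \<alpha> i)) = \<alpha>"
    by (rule poly_mapping_eqI) (simp add: lookup_sum lookup_single when_def)
  ultimately show ?thesis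
    by (simp add: prod_single_one const_poly_def mult_single)
qed

definition affine_form :: "real ^ 'n ^ 'n \<Rightarrow> real ^ 'n \<Rightarrow> 'n::finite \<Rightarrow> 'n real_mpoly" where
  "affine_form B b i = (\<Sum>j\<in>UNIV. const_poly (B $ i $ j) * var_poly j) + const_poly (b $ i)"

lemma affine_form_id: "affine_form (mat 1) 0 i = var_poly i"
proof -
  have "affine_form (mat 1) 0 i = (\<Sum>j\<in>UNIV. if j = i then var_poly i else 0)"
    unfolding affine_form_def mat_def
    by (simp only: zero_index const_poly_zero add_0_right vec_lambda_beta, rule sum.cong)
       (auto simp: const_poly_zero const_poly_one)
  then show ?thesis by simp
qed

lemma total_degree_affine_form: "total_degree (affine_form B b i) \<le> 1"
proof -
  have "total_degree (const_poly (B $ i $ j) * var_poly j) \<le> 1" for j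
    using total_degree_mult[of "const_poly (B $ i $ j)" "var_poly j"] total_degree_var[of j] by simp
  then have "total_degree (\<Sum>j\<in>UNIV. const_poly (B $ i $ j) * var_poly j) \<le> 1"
    by (intro total_degree_sum)
  then show ?thesis
    unfolding affine_form_def by (intro order_trans[OF total_degree_add]) simp
qed

text \<open>Allows \<open>p\<close>, \<open>q\<close> and \<open>p + q\<close> to be expanded over
  one common index set, which makes additivity a termwise matter.\<close>

lemma affine_subst_superset:
  assumes "finite S" "Poly_Mapping.keys p \<subseteq> S"
  shows "affine_subst p B b =
    (\<Sum>\<alpha>\<in>S. const_poly (Poly_Mapping.lookup p \<alpha>) * (\<Prod>i\<in>UNIV. affine_form B b i ^ Poly_Mapping.lookup \<alpha> i))"
  unfolding affine_subst_def affine_form_def using assms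
  by (intro sum.mono_neutral_left) (auto simp: in_keys_iff const_poly_zero)

lemma affine_subst_zero: "affine_subst 0 B b = 0"
  by (simp add: affine_subst_def)

lemma affine_subst_single:
  "affine_subst (Poly_Mapping.single \<alpha> c) B b =
     const_poly c * (\<Prod>i\<in>UNIV. affine_form B b i ^ Poly_Mapping.lookup \<alpha> i)"
  by (subst affine_subst_superset[of "{\<alpha>}"]) auto

lemma affine_subst_add: "affine_subst (p + q) B b = affine_subst p B b + affine_subst q B b"
proof -
  have fin: "finite (Poly_Mapping.keys p \<union> Poly_Mapping.keys q)" by simp
  show ?thesis
    using Poly_Mapping.keys_add[of p q]
    by (simp add: affine_subst_superset[OF fin] lookup_add const_poly_add distrib_right sum.distrib)
qed

lemma affine_subst_sum: "affine_subst (sum P I) B b = (\<Sum>i\<in>I. affine_subst (P i) B b)"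
  by (induction I rule: infinite_finite_induct) (auto simp: affine_subst_zero affine_subst_add)

text \<open>By bilinearity the claim reduces to monomials, where exponents add.\<close>

lemma affine_subst_mult: "affine_subst (p * q) B b = affine_subst p B b * affine_subst q B b"
proof -
  have 1: "affine_subst (Poly_Mapping.single \<alpha> c * Poly_Mapping.single \<beta> d) B b =
      affine_subst (Poly_Mapping.single \<alpha> c) B b * affine_subst (Poly_Mapping.single \<beta> d) B b" for \<alpha> \<beta> c d
    by (simp add: mult_single affine_subst_single lookup_add power_add prod.distrib const_poly_mult mult_ac)
  \<comment> \<open>Generic coefficient families keep \<open>p\<close> and \<open>q\<close> out of
    their own expansions; \<open>sum_single\<close>, read backwards, restores them
    afterwards.\<close>
  have "affine_subst ((\<Sum>\<alpha>\<in>K. Poly_Mapping.single \<alpha> (c \<alpha>)) * (\<Sum>\<beta>\<in>L. Poly_Mapping.single \<beta> (d \<beta>))) B b =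
      affine_subst (\<Sum>\<alpha>\<in>K. Poly_Mapping.single \<alpha> (c \<alpha>)) B b *
      affine_subst (\<Sum>\<beta>\<in>L. Poly_Mapping.single \<beta> (d \<beta>)) B b" for K L c d
    by (simp only: sum_product affine_subst_sum 1)
  from this[of "Poly_Mapping.lookup p" "Poly_Mapping.keys p" "Poly_Mapping.lookup q" "Poly_Mapping.keys q"]
  show ?thesis
    by (simp only: sum_single[symmetric])
qed

lemma affine_subst_const: "affine_subst (const_poly c) B b = const_poly c"
  using affine_subst_single[of 0 c B b] by (simp add: const_poly_def)

lemma affine_subst_var: "affine_subst (var_poly i) B b = affine_form B b i"
proof -
  have "(\<Prod>k\<in>UNIV. affine_form B b k ^ Poly_Mapping.lookup (Poly_Mapping.single i 1) k) =
      (\<Prod>k\<in>UNIV. if k = i then affine_form B b k else 1)"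
    by (intro prod.cong) (auto simp: lookup_single)
  then show ?thesis
    by (simp add: var_poly_def affine_subst_single const_poly_one)
qed

lemma affine_subst_one: "affine_subst 1 B b = 1"
  using affine_subst_const[of 1 B b] by (simp add: const_poly_one)

lemma affine_subst_power: "affine_subst (p ^ k) B b = affine_subst p B b ^ k"
  by (induction k) (auto simp: affine_subst_mult affine_subst_one)

lemma affine_subst_prod: "affine_subst (prod P I) B b = (\<Prod>i\<in>I. affine_subst (P i) B b)"
  by (induction I rule: infinite_finite_induct) (auto simp: affine_subst_one affine_subst_mult)

text \<open>Composition of affine maps, checked on the generators; the homomorphism laws extend it
  to all polynomials in \<open>affine_subst_compose\<close>.\<close>

lemma affine_subst_affine_form:
  "affine_subst (affine_form B b i) C c = affine_form (B ** C) (B *v c + b) i"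
proof -
  have "affine_subst (affine_form B b i) C c =
      (\<Sum>j\<in>UNIV. \<Sum>k\<in>UNIV. const_poly (B $ i $ j) * (const_poly (C $ j $ k) * var_poly k)) +
      (\<Sum>j\<in>UNIV. const_poly (B $ i $ j) * const_poly (c $ j)) + const_poly (b $ i)"
    unfolding affine_form_def[of B]
    by (simp add: affine_subst_add affine_subst_sum affine_subst_mult affine_subst_const affine_subst_var
        affine_form_def distrib_left sum.distrib sum_distrib_left)
  also have "(\<Sum>j\<in>UNIV. \<Sum>k\<in>UNIV. const_poly (B $ i $ j) * (const_poly (C $ j $ k) * var_poly k)) =
      (\<Sum>k\<in>UNIV. const_poly ((B ** C) $ i $ k) * var_poly k)"
    by (subst sum.swap)
       (simp add: matrix_matrix_mult_def const_poly_sum const_poly_mult sum_distrib_right mult.assoc)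
  also have "(\<Sum>j\<in>UNIV. const_poly (B $ i $ j) * const_poly (c $ j)) = const_poly ((B *v c) $ i)"
    by (simp add: matrix_vector_mult_def const_poly_sum const_poly_mult)
  finally show ?thesis
    by (simp add: affine_form_def const_poly_add add.assoc)
qed

lemma affine_subst_compose:
  "affine_subst (affine_subst p B b) C c = affine_subst p (B ** C) (B *v c + b)"
  unfolding affine_subst_superset[OF finite_keys order_refl, of p]
  by (simp add: affine_subst_sum affine_subst_mult affine_subst_prod affine_subst_power affine_subst_const
      affine_subst_affine_form)

lemma affine_subst_id: "affine_subst p (mat 1) 0 = p"
  by (subst affine_subst_superset[OF finite_keys order_refl])
     (simp add: affine_form_id single_eq_const_mult_prod_var[symmetric] sum_single[symmetric])

lemma total_degree_affine_subst_le: "total_degree (affine_subst p B b) \<le> total_degree p"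
  unfolding affine_subst_superset[OF finite_keys order_refl, of p]
proof (rule total_degree_sum)
  fix \<alpha> assume \<alpha>: "\<alpha> \<in> Poly_Mapping.keys p"
  have "total_degree (affine_form B b i ^ k) \<le> k" for i k
    using order_trans[OF total_degree_power mult_le_mono2[OF total_degree_affine_form[of B b i]], of k]
    by simp
  then have "total_degree (\<Prod>i\<in>UNIV. affine_form B b i ^ Poly_Mapping.lookup \<alpha> i) \<le> monom_degree \<alpha>"
    unfolding monom_degree_def by (intro order_trans[OF total_degree_prod] sum_mono)
  also have "\<dots> \<le> total_degree p"
    using \<alpha> by (rule monom_degree_le_total_degree)
  finally show "total_degree (const_poly (Poly_Mapping.lookup p \<alpha>) *
      (\<Prod>i\<in>UNIV. affine_form B b i ^ Poly_Mapping.lookup \<alpha> i)) \<le> total_degree p"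
    by (intro order_trans[OF total_degree_mult]) simp
qed

text \<open>Substitution never raises the degree, and an invertible one is undone by another affine
  substitution.\<close>

lemma total_degree_affine_subst:
  assumes "B ** C = mat 1"
  shows "total_degree (affine_subst p B b) = total_degree p"
proof (rule antisym)
  \<comment> \<open>The shift \<open>C *v (- b)\<close> is chosen so that \<open>B\<close> sends it
    to \<open>- b\<close>, cancelling the constant part.\<close>
  have "affine_subst (affine_subst p B b) C (C *v (- b)) = p"
    by (simp add: affine_subst_compose assms matrix_vector_mul_assoc affine_subst_id)
  then show "total_degree p \<le> total_degree (affine_subst p B b)"
    by (metis total_degree_affine_subst_le)
qed (rule total_degree_affine_subst_le)

section \<open>Exact cubature\<close>

text \<open>Integrability and value in one statement, so that monomials can be summed with
  coefficients of either sign.\<close>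

lemma has_bochner_integral_monomial_canonical_simplex:
  fixes \<alpha> :: "'n::finite \<Rightarrow> nat"
  shows "has_bochner_integral lborel (\<lambda>x. indicator canonical_simplex x * (\<Prod>i\<in>UNIV. (x $ i) ^ \<alpha> i))
           ((\<Prod>i\<in>UNIV. fact (\<alpha> i)) / fact (CARD('n) + sum \<alpha> UNIV))"
proof (rule has_bochner_integral_nn_integral)
  have [measurable]: "canonical_simplex \<in> sets (borel :: (real ^ 'n) measure)"
    by (intro borel_closed closed_canonical_simplex)
  show "(\<lambda>x. indicator canonical_simplex x * (\<Prod>i\<in>UNIV. (x $ i) ^ \<alpha> i)) \<in> borel_measurable lborel"
    by measurable
  show "AE x :: real ^ 'n in lborel. 0 \<le> indicator canonical_simplex x * (\<Prod>i\<in>UNIV. (x $ i) ^ \<alpha> i)"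
    by (rule AE_I2) (auto simp: indicator_def canonical_simplex_iff intro!: prod_nonneg)
  have "(\<integral>\<^sup>+x. ennreal (indicator canonical_simplex x * (\<Prod>i\<in>UNIV. (x $ i) ^ \<alpha> i)) \<partial>lborel) =
      (\<integral>\<^sup>+x. ennreal (\<Prod>i\<in>UNIV. (x $ i) ^ \<alpha> i) * indicator canonical_simplex x \<partial>lborel)"
    by (intro nn_integral_cong) (simp add: indicator_def)
  then show "(\<integral>\<^sup>+x. ennreal (indicator canonical_simplex x * (\<Prod>i\<in>UNIV. (x $ i) ^ \<alpha> i)) \<partial>lborel) =
      ennreal ((\<Prod>i\<in>UNIV. fact (\<alpha> i)) / fact (CARD('n) + sum \<alpha> UNIV))"
    by (simp only: nn_integral_monomial_canonical_simplex)
qed (auto intro!: divide_nonneg_nonneg prod_nonneg)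

lemma integral_poly_eval_canonical_simplex:
  fixes p :: "'n::finite real_mpoly"
  shows "(LINT x|lborel. indicator canonical_simplex x * poly_eval p x) =
    (\<Sum>\<alpha>\<in>Poly_Mapping.keys p. Poly_Mapping.lookup p \<alpha> *
       ((\<Prod>i\<in>UNIV. fact (Poly_Mapping.lookup \<alpha> i)) / fact (CARD('n) + monom_degree \<alpha>)))"
proof (rule has_bochner_integral_integral_eq)
  have "has_bochner_integral lborel
    (\<lambda>x. \<Sum>\<alpha>\<in>Poly_Mapping.keys p. Poly_Mapping.lookup p \<alpha> *
       (indicator canonical_simplex x * (\<Prod>i\<in>UNIV. (x $ i) ^ Poly_Mapping.lookup \<alpha> i)))
    (\<Sum>\<alpha>\<in>Poly_Mapping.keys p. Poly_Mapping.lookup p \<alpha> *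
       ((\<Prod>i\<in>UNIV. fact (Poly_Mapping.lookup \<alpha> i)) / fact (CARD('n) + monom_degree \<alpha>)))"
    unfolding monom_degree_def
    by (intro has_bochner_integral_sum has_bochner_integral_mult_right
        has_bochner_integral_monomial_canonical_simplex)
  then show "has_bochner_integral lborel (\<lambda>x. indicator canonical_simplex x * poly_eval p x)
    (\<Sum>\<alpha>\<in>Poly_Mapping.keys p. Poly_Mapping.lookup p \<alpha> *
       ((\<Prod>i\<in>UNIV. fact (Poly_Mapping.lookup \<alpha> i)) / fact (CARD('n) + monom_degree \<alpha>)))"
    by (simp add: poly_eval_def sum_distrib_left mult_ac)
qed

text \<open>Every component is summed over the keys of \<open>p\<close>, independently of
  \<open>j\<close>, so that the sums over \<open>j\<close> and over exponents can later be
  exchanged.\<close>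

lemma poly_eval_bombieri_hom_component:
  "poly_eval (bombieri (hom_component j p)) x =
     (\<Sum>\<alpha>\<in>Poly_Mapping.keys p. if monom_degree \<alpha> = j
        then Poly_Mapping.lookup p \<alpha> * (\<Prod>i\<in>UNIV. fact (Poly_Mapping.lookup \<alpha> i)) *
          (\<Prod>i\<in>UNIV. (x $ i) ^ Poly_Mapping.lookup \<alpha> i) else 0)"
proof -
  have lookup: "Poly_Mapping.lookup (bombieri q) \<alpha> =
      Poly_Mapping.lookup q \<alpha> * (\<Prod>i\<in>UNIV. fact (Poly_Mapping.lookup \<alpha> i))" for q :: "'a real_mpoly" and \<alpha>
    by (simp add: bombieri_def lookup_mapp when_def in_keys_iff)
  have "Poly_Mapping.keys (bombieri (hom_component j p)) \<subseteq> Poly_Mapping.keys p"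
    by (auto simp: in_keys_iff lookup lookup_hom_component split: if_splits)
  then show ?thesis
    by (subst poly_eval_superset[OF finite_keys])
       (auto intro!: sum.cong simp: lookup lookup_hom_component)
qed

text \<open>Only the zero exponent has degree 0, so this form is constant; the \<open>x\<close> is
  arbitrary, and the case \<open>j = 0\<close> can be treated like the others.\<close>

lemma lookup_bombieri_hom_component_0:
  "Poly_Mapping.lookup (bombieri (hom_component 0 p)) 0 = poly_eval (bombieri (hom_component 0 p)) x"
proof -
  have "\<alpha> = 0" if "monom_degree \<alpha> = 0" for \<alpha> :: "'a \<Rightarrow>\<^sub>0 nat"
    using that by (intro poly_mapping_eqI) (simp add: monom_degree_def)
  then have "Poly_Mapping.keys (bombieri (hom_component 0 p)) \<subseteq> {0}"
    by (auto simp: in_keys_iff bombieri_def lookup_mapp lookup_hom_component when_def split: if_splits)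
  then show ?thesis
    by (subst poly_eval_superset[of "{0}"]) auto
qed

text \<open>On the diagonal all monomials of degree \<open>j\<close> take the same value
  \<open>s ^ j\<close>. Hence one node per degree suffices.\<close>

lemma poly_eval_bombieri_hom_component_scaleR_one:
  "poly_eval (bombieri (hom_component j p)) (s *\<^sub>R 1) =
     (\<Sum>\<alpha>\<in>Poly_Mapping.keys p. if monom_degree \<alpha> = j
        then Poly_Mapping.lookup p \<alpha> * (\<Prod>i\<in>UNIV. fact (Poly_Mapping.lookup \<alpha> i)) * s ^ j else 0)"
  unfolding poly_eval_bombieri_hom_component
  by (intro sum.cong) (auto simp: monom_degree_def power_sum)

lemma prod_add_eq_fact_div: "(\<Prod>k=1..j. real (n + k)) = fact (n + j) / fact n"
proof (induction j)
  case (Suc j)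
  have "(\<Prod>k=1..Suc j. real (n + k)) = (\<Prod>k=1..j. real (n + k)) * real (n + Suc j)"
    by simp
  also have "\<dots> = real (n + Suc j) * fact (n + j) / fact n"
    by (simp only: Suc.IH mult.commute times_divide_eq_right)
  also have "real (n + Suc j) * fact (n + j) = fact (n + Suc j)"
    by simp
  finally show ?case .
qed simp

lemma power_inverse_root_prod:
  assumes "1 \<le> j"
  shows "(1 / root j (\<Prod>k=1..j. real (n + k))) ^ j = fact n / fact (n + j)"
proof -
  have "root j (\<Prod>k=1..j. real (n + k)) ^ j = (\<Prod>k=1..j. real (n + k))"
    using assms by (intro real_root_pow_pos2 prod_nonneg) auto
  then show ?thesis
    by (simp only: power_divide power_one prod_add_eq_fact_div) simp
qed

text \<open>Each factor is at least \<open>CARD('n)\<close>, hence so is the root of the product,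
  and the coordinate sum is at most 1.\<close>

lemma scaled_one_mem_canonical_simplex:
  assumes "1 \<le> j"
  shows "(1 / root j (\<Prod>k=1..j. real (CARD('n) + k))) *\<^sub>R (1 :: real ^ 'n) \<in> canonical_simplex"
proof -
  let ?P = "\<Prod>k=1..j. real (CARD('n) + k)"
  have "real CARD('n) ^ j \<le> ?P"
    using prod_mono[of "{1..j}" "\<lambda>_. real CARD('n)" "\<lambda>k. real (CARD('n) + k)"] by simp
  then have "root j (real CARD('n) ^ j) \<le> root j ?P"
    using assms by (intro real_root_le_mono) auto
  then have "real CARD('n) \<le> root j ?P"
    using assms by (simp add: real_root_power_cancel)
  moreover have "0 < real CARD('n)"
    by simp
  ultimately have "0 < root j ?P" "real CARD('n) * (1 / root j ?P) \<le> 1"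
    by (auto simp: field_simps simp del: zero_less_card_finite of_nat_0_less_iff)
  then show ?thesis
    by (simp add: canonical_simplex_iff)
qed

lemma integral_poly_eval_canonical_simplex_bombieri:
  fixes p :: "'n::finite real_mpoly" and \<xi> :: "nat \<Rightarrow> real ^ 'n"
  assumes "total_degree p = t"
    and \<xi>: "\<And>j. j \<in> {1..t} \<Longrightarrow> \<xi> j = (1 / root j (\<Prod>k=1..j. real (CARD('n) + k))) *\<^sub>R 1"
  shows "(LINT x|lborel. indicator canonical_simplex x * poly_eval p x) =
    1 / fact CARD('n) * (Poly_Mapping.lookup (bombieri (hom_component 0 p)) 0 +
      (\<Sum>j=1..t. poly_eval (bombieri (hom_component j p)) (\<xi> j)))"
proof -
  let ?c = "\<lambda>\<alpha>. Poly_Mapping.lookup p \<alpha> * (\<Prod>i\<in>UNIV. fact (Poly_Mapping.lookup \<alpha> i))"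
  \<comment> \<open>The contribution of degree \<open>j\<close>. For \<open>j = 0\<close> the weight
    is 1, so the constant term fits the same pattern.\<close>
  define T where "T = (\<lambda>j. \<Sum>\<alpha>\<in>Poly_Mapping.keys p.
    if monom_degree \<alpha> = j then ?c \<alpha> * (fact CARD('n) / fact (CARD('n) + j)) else 0)"
  have "Poly_Mapping.lookup (bombieri (hom_component 0 p)) 0 = T 0"
    using poly_eval_bombieri_hom_component_scaleR_one[of 0 p 1]
    by (simp add: lookup_bombieri_hom_component_0[of p 1] T_def cong: if_cong)
  moreover have "poly_eval (bombieri (hom_component j p)) (\<xi> j) = T j" if "j \<in> {1..t}" for j
  proof -
    have "1 \<le> j" using that by simp
    then show ?thesis
      unfolding \<xi>[OF that] poly_eval_bombieri_hom_component_scaleR_one T_def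
      by (simp only: power_inverse_root_prod)
  qed
  ultimately have "Poly_Mapping.lookup (bombieri (hom_component 0 p)) 0 +
      (\<Sum>j=1..t. poly_eval (bombieri (hom_component j p)) (\<xi> j)) = (\<Sum>j\<le>t. T j)"
    by (simp add: atMost_atLeast0 sum.atLeast_Suc_atMost)
  \<comment> \<open>After exchanging the sums, each exponent survives for exactly one
    \<open>j\<close>, its own degree, which is at most \<open>t\<close>.\<close>
  also have "\<dots> = (\<Sum>\<alpha>\<in>Poly_Mapping.keys p. ?c \<alpha> * (fact CARD('n) / fact (CARD('n) + monom_degree \<alpha>)))"
    unfolding T_def using monom_degree_le_total_degree[of _ p]
    by (subst sum.swap) (auto intro!: sum.cong simp: assms(1))
  finally show ?thesis
    by (simp add: integral_poly_eval_canonical_simplex sum_distrib_left)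
qed

lemma borel_measurable_poly_eval [measurable]: "poly_eval p \<in> borel_measurable borel"
  unfolding poly_eval_def by measurable

theorem mainTheorem3:
  fixes \<Omega> :: "(real ^ 'n) set"
    and a :: "real ^ 'n"
    and A :: "real ^ 'n ^ 'n"
    and f g :: "'n real_mpoly"
    and t :: nat
    and \<xi> \<psi> :: "nat \<Rightarrow> real ^ 'n"
  assumes "full_dimensional_simplex \<Omega>"
    and "a extreme_point_of \<Omega>"
    and "invertible A"
    and "\<And>x. x \<in> \<Omega> \<longleftrightarrow> A *v (x - a) \<in> canonical_simplex"
    and "total_degree f = t"
    and "g = affine_subst f (matrix_inv A) a"
    and "\<And>j. j \<in> {1..t} \<Longrightarrow> \<xi> j = (1 / root j (\<Prod>k=1..j. real (CARD('n) + k))) *\<^sub>R 1"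
    and "\<And>j. j \<in> {1..t} \<Longrightarrow> \<psi> j = matrix_inv A *v \<xi> j + a"
  shows "total_degree g = t
    \<and> (\<forall>j\<in>{1..t}. \<xi> j \<in> canonical_simplex)
    \<and> (\<forall>j\<in>{1..t}. \<psi> j \<in> \<Omega>)
    \<and> (LINT x:\<Omega>|lebesgue. poly_eval f x) =
        1 / \<bar>det A\<bar> * (1 / fact CARD('n)) *
          (Poly_Mapping.lookup (bombieri (hom_component 0 g)) 0
           + (\<Sum>j=1..t. poly_eval (bombieri (hom_component j g)) (A *v (\<psi> j - a))))"
proof -
  note \<Omega> = assms(4) and g = assms(6) and \<xi> = assms(7) and \<psi> = assms(8)
  note right = invertible_matrix_inv_right[OF assms(3)]
  have deg: "total_degree g = t"
    unfolding g assms(5)[symmetric]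
    by (rule total_degree_affine_subst[OF invertible_matrix_inv_left[OF assms(3)]])
  have mem: "\<xi> j \<in> canonical_simplex" if "j \<in> {1..t}" for j
    using that unfolding \<xi>[OF that] by (intro scaled_one_mem_canonical_simplex) simp
  \<comment> \<open>\<open>\<psi> j\<close> is the preimage of \<open>\<xi> j\<close>, so both its
    membership in \<open>\<Omega>\<close> and the evaluation of the forms reduce to
    \<open>\<xi> j\<close>.\<close>
  have A\<psi>: "A *v (\<psi> j - a) = \<xi> j" if "j \<in> {1..t}" for j
    by (simp add: \<psi>[OF that] matrix_vector_mul_assoc right)
  have "det A * det (matrix_inv A) = 1"
    using arg_cong[OF right, of det] by (simp add: det_mul)
  then have nz: "det (matrix_inv A) \<noteq> 0" and "det (matrix_inv A) = 1 / det A"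
    by (auto simp: eq_divide_eq mult.commute)
  then have det: "\<bar>det (matrix_inv A)\<bar> = 1 / \<bar>det A\<bar>"
    by (simp add: abs_divide)
  \<comment> \<open>\<open>\<Omega>\<close> is the preimage of the closed canonical simplex under a
    Borel map.\<close>
  have [measurable]: "\<Omega> \<in> sets borel"
  proof -
    have "(\<lambda>x. A *v (x - a)) \<in> borel_measurable borel"
      by measurable
    from measurable_sets[OF this borel_closed[OF closed_canonical_simplex]]
    have "(\<lambda>x. A *v (x - a)) -` canonical_simplex \<in> sets borel"
      by simp
    also have "(\<lambda>x. A *v (x - a)) -` canonical_simplex = \<Omega>"
      using \<Omega> by auto
    finally show ?thesis .
  qed
  \<comment> \<open>\<open>lebesgue\<close> is the completion of \<open>lborel\<close>, and the
    integrand is Borel.\<close>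
  have "(LINT x:\<Omega>|lebesgue. poly_eval f x) = (LINT x|lborel. indicator \<Omega> x * poly_eval f x)"
    unfolding set_lebesgue_integral_def real_scaleR_def by (rule integral_completion) measurable
  also have "\<dots> = \<bar>det (matrix_inv A)\<bar> *
      (LINT y|lborel. indicator \<Omega> (matrix_inv A *v y + a) * poly_eval f (matrix_inv A *v y + a))"
    by (rule integral_lborel_affine[OF nz, symmetric]) measurable
  \<comment> \<open>Applying \<open>A\<close> after subtracting \<open>a\<close> recovers
    \<open>y\<close>, so the indicator of \<open>\<Omega>\<close> turns into that of the canonical
    simplex.\<close>
  also have "(LINT y|lborel. indicator \<Omega> (matrix_inv A *v y + a) * poly_eval f (matrix_inv A *v y + a)) =
      (LINT y|lborel. indicator canonical_simplex y * poly_eval g y)"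
    by (simp add: g poly_eval_affine_subst indicator_def \<Omega> matrix_vector_mul_assoc right)
  also have "\<dots> = 1 / fact CARD('n) * (Poly_Mapping.lookup (bombieri (hom_component 0 g)) 0 +
      (\<Sum>j=1..t. poly_eval (bombieri (hom_component j g)) (\<xi> j)))"
    using deg \<xi> by (rule integral_poly_eval_canonical_simplex_bombieri)
  also have "(\<Sum>j=1..t. poly_eval (bombieri (hom_component j g)) (\<xi> j)) =
      (\<Sum>j=1..t. poly_eval (bombieri (hom_component j g)) (A *v (\<psi> j - a)))"
    by (intro sum.cong refl) (simp add: A\<psi>)
  finally have "(LINT x:\<Omega>|lebesgue. poly_eval f x) =
        1 / \<bar>det A\<bar> * (1 / fact CARD('n)) *
          (Poly_Mapping.lookup (bombieri (hom_component 0 g)) 0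
           + (\<Sum>j=1..t. poly_eval (bombieri (hom_component j g)) (A *v (\<psi> j - a))))"
    by (simp add: det)
  moreover have "\<psi> j \<in> \<Omega>" if "j \<in> {1..t}" for j
    using mem[OF that] by (simp add: \<Omega> A\<psi>[OF that])
  ultimately show ?thesis
    using deg mem by simp
qed

end
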